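(* Let $m\ge1$, $C_m=\mathbb Z/m\mathbb Z$ and $\zeta$ a primitive $m$-th root of unity. (i) The operator system $C^*(C_m)$ is its own dual under the pairing $$C^*(C_m)\times C^*(C_m)\to\mathbb C,\qquad\langle f,g\rangle_{C^*(C_m)}:=(f\star g)(0)=\sum_lf_l\,g_{-l},$$ i.e. $f\mapsto\langle f,\cdot\rangle_{C^*(C_m)}$ is a complete order isomorphism from $C^*(C_m)$ onto $C^*(C_m)^d$. (ii) The pairing $$C^*(C_m)\times l^\infty(C_m)\to\mathbb C,\qquad(c,g)\mapsto\langle c,\mathcal Fg\rangle_{C^*(C_m)}=\sum_{l,k}c_l\,g(k)\,\zeta^{kl}$$ gives a duality between the operator systems $C^*(C_m)$ and $l^\infty(C_m)$, i.e. it induces a complete order isomorphism of each onto the dual of the other.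
   Context: $C^*(C_m)$ is the group algebra of $C_m$: functions $f=(f_l)_{l\in C_m}$ with convolution $(f\star g)(k)=\sum_lf(k-l)g(l)$ and involution $f^*_l=\overline{f_{-l}}$, a $C^*$-algebra acting on $l^2(C_m)$ by convolution (circulant matrices). $l^\infty(C_m)$ is the $C^*$-algebra of functions on $C_m$ with pointwise operations. The finite Fourier transform is $(\mathcal F\psi)(k)=\sum_{l=0}^{m-1}\psi(l)\bar\zeta^{kl}$. For a finite-dimensional operator system $E$, the dual $E^d$ is the dual vector space with matrix order $M_k(E^d)_+=\{(\phi_{ij}):\sum_{ij}\phi_{ij}(x_{ij})\ge0\ \forall(x_{ij})\in M_k(E)_+\}$. A complete order isomorphism is an invertible linear map which, together with its inverse, is completely positive. *)

theory Defs
  imports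
    Complex_Main
    "HOL-Library.Function_Algebras"
    "HOL-Library.Complex_Order"
    "Jordan_Normal_Form.Matrix"
    "Berlekamp_Zassenhaus.Finite_Field"
begin

section \<open>Matrix-ordered spaces, duals and complete order isomorphisms\<close>

text \<open>
  All complex vector spaces below are subspaces of a space of functions
  \<^typ>\<open>'x \<Rightarrow> complex\<close> with pointwise operations; this covers function spaces on a
  finite group as well as spaces of linear functionals.
  The field \<open>mcone\<close> gives the matrix order: \<open>mcone E k\<close> is \<open>M\<^sub>k(E)\<^sub>+\<close>, a set of
  \<open>k \<times> k\<close> matrices with entries in \<open>vspace E\<close>. The remaining structure of an operator system
  (involution and order unit) does not enter the notion of a complete order isomorphism.
\<close>

record 'x matrix_ordered =
  vspace :: "('x \<Rightarrow> complex) set"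
  mcone :: "nat \<Rightarrow> ('x \<Rightarrow> complex) mat set"

definition cscale :: "complex \<Rightarrow> ('x \<Rightarrow> complex) \<Rightarrow> 'x \<Rightarrow> complex" where
  "cscale c f = (\<lambda>x. c * f x)"

definition linear_on ::
  "('x \<Rightarrow> complex) set \<Rightarrow> (complex \<Rightarrow> 'b \<Rightarrow> 'b) \<Rightarrow> (('x \<Rightarrow> complex) \<Rightarrow> 'b::ab_group_add) \<Rightarrow> bool" where
  "linear_on V s T \<longleftrightarrow>
     (\<forall>f\<in>V. \<forall>g\<in>V. T (f + g) = T f + T g) \<and>
     (\<forall>c. \<forall>f\<in>V. T (cscale c f) = s c (T f))"

text \<open>
  HOL functions are total, so a functional on \<open>vspace E\<close> is represented by its extension by zero.
  The condition \<open>0 \<le> z\<close> on a complex number \<open>z\<close> means that \<open>z\<close> is real and nonnegative.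
\<close>

definition dual :: "'x matrix_ordered \<Rightarrow> ('x \<Rightarrow> complex) matrix_ordered" where
  "dual E =
    (let E' = {\<phi>. linear_on (vspace E) (*) \<phi> \<and> (\<forall>x. x \<notin> vspace E \<longrightarrow> \<phi> x = 0)} in
     \<lparr> vspace = E',
       mcone = (\<lambda>k. {\<Phi> \<in> carrier_mat k k.
         (\<forall>i<k. \<forall>j<k. \<Phi> $$ (i, j) \<in> E') \<and>
         (\<forall>X \<in> mcone E k. 0 \<le> (\<Sum>i<k. \<Sum>j<k. (\<Phi> $$ (i, j)) (X $$ (i, j))))}) \<rparr>)"

definition completely_positive ::
  "'x matrix_ordered \<Rightarrow> 'y matrix_ordered \<Rightarrow> (('x \<Rightarrow> complex) \<Rightarrow> 'y \<Rightarrow> complex) \<Rightarrow> bool" where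
  "completely_positive E F T \<longleftrightarrow> (\<forall>k\<ge>1. \<forall>X \<in> mcone E k. map_mat T X \<in> mcone F k)"

definition complete_order_iso ::
  "'x matrix_ordered \<Rightarrow> 'y matrix_ordered \<Rightarrow> (('x \<Rightarrow> complex) \<Rightarrow> 'y \<Rightarrow> complex) \<Rightarrow> bool" where
  "complete_order_iso E F T \<longleftrightarrow>
     linear_on (vspace E) cscale T \<and>
     bij_betw T (vspace E) (vspace F) \<and>
     completely_positive E F T \<and>
     completely_positive F E (inv_into (vspace E) T)"


section \<open>The operator systems of the cyclic group\<close>

text \<open>
  The cyclic group \<open>C\<^sub>m\<close> is the additive group of \<^typ>\<open>'m mod_ring\<close>, where \<open>m = CARD('m)\<close>;
  every \<open>m \<ge> 1\<close> occurs.
\<close>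

definition conv ::
  "('m::finite mod_ring \<Rightarrow> complex) \<Rightarrow> ('m mod_ring \<Rightarrow> complex) \<Rightarrow> 'm mod_ring \<Rightarrow> complex"
    (infixl \<open>\<star>\<close> 70) where
  "f \<star> g = (\<lambda>k. \<Sum>l\<in>UNIV. f (k - l) * g l)"

definition conv_adj :: "('m::finite mod_ring \<Rightarrow> complex) \<Rightarrow> 'm mod_ring \<Rightarrow> complex" where
  "conv_adj f = (\<lambda>l. cnj (f (- l)))"

text \<open>
  A \<open>C\<^sup>*\<close>-algebra \<open>A\<close> with product \<open>prd\<close> and involution \<open>adj\<close> is an operator system whose
  cone \<open>M\<^sub>k(A)\<^sub>+\<close> consists of the positive elements of the \<open>C\<^sup>*\<close>-algebra \<open>M\<^sub>k(A)\<close>,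
  i.e. of the elements \<open>Y\<^sup>* Y\<close>, with entries \<open>(Y\<^sup>* Y)\<^sub>i\<^sub>j = \<Sum>\<^sub>n (Y\<^sub>n\<^sub>i)\<^sup>* Y\<^sub>n\<^sub>j\<close>.
  For a faithful action on a Hilbert space \<open>H\<close> (here \<open>l\<^sup>2(C\<^sub>m)\<close>, by convolution or by
  multiplication) these are the matrices acting on \<open>H\<^sup>k\<close> as positive operators.
\<close>

definition algebra_cone ::
  "('a \<Rightarrow> 'a \<Rightarrow> 'a) \<Rightarrow> ('a \<Rightarrow> 'a) \<Rightarrow> nat \<Rightarrow> 'a::comm_monoid_add mat set" where
  "algebra_cone prd adj k =
     {mat k k (\<lambda>(i, j). \<Sum>n<k. prd (adj (Y $$ (n, i))) (Y $$ (n, j))) | Y. Y \<in> carrier_mat k k}"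

definition group_cstar :: "'m::finite mod_ring matrix_ordered" where
  "group_cstar = \<lparr> vspace = UNIV, mcone = algebra_cone (\<star>) conv_adj \<rparr>"

definition linf :: "'m::finite mod_ring matrix_ordered" where
  "linf = \<lparr> vspace = UNIV, mcone = algebra_cone (\<lambda>f g x. f x * g x) (\<lambda>f x. cnj (f x)) \<rparr>"

definition primitive_root :: "nat \<Rightarrow> complex \<Rightarrow> bool" where
  "primitive_root m \<zeta> \<longleftrightarrow> \<zeta> ^ m = 1 \<and> (\<forall>j. 0 < j \<and> j < m \<longrightarrow> \<zeta> ^ j \<noteq> 1)"

text \<open>
  \<open>zpow \<zeta> k l\<close> is \<open>\<zeta>\<^bsup>kl\<^esup>\<close>, computed with the representatives of \<open>k\<close> and \<open>l\<close>
  in \<open>{0, \<dots>, m - 1}\<close>.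
\<close>

definition zpow :: "complex \<Rightarrow> 'm::finite mod_ring \<Rightarrow> 'm mod_ring \<Rightarrow> complex" where
  "zpow \<zeta> k l = \<zeta> powi (to_int_mod_ring k * to_int_mod_ring l)"

definition fourier ::
  "complex \<Rightarrow> ('m::finite mod_ring \<Rightarrow> complex) \<Rightarrow> 'm mod_ring \<Rightarrow> complex" where
  "fourier \<zeta> \<psi> = (\<lambda>k. \<Sum>l\<in>UNIV. \<psi> l * zpow (cnj \<zeta>) k l)"

definition pairing ::
  "('m::finite mod_ring \<Rightarrow> complex) \<Rightarrow> ('m mod_ring \<Rightarrow> complex) \<Rightarrow> complex" where
  "pairing f g = (f \<star> g) 0"

end

theory Submission
  imports Defs
begin

text \<open>
  In suitable coordinates both operator systems are functions on the finite set \<open>C\<^sub>m\<close> with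
  pointwise positivity: this is the definition for \<open>l\<^sup>\<infinity>(C\<^sub>m)\<close>, and the discrete Fourier transform,
  a bijective \<open>*\<close>-homomorphism from convolution to pointwise multiplication, does it for
  \<open>C\<^sup>*(C\<^sub>m)\<close>. In these coordinates every pairing of the theorem is a positive multiple of
  \<open>\<Sum>\<^sub>x f(x) g(x)\<close>, so that all three claims follow from the self-duality of the cone of positive
  semidefinite matrices under \<open>(A, B) \<mapsto> \<Sum>\<^sub>i\<^sub>j A\<^sub>i\<^sub>j B\<^sub>i\<^sub>j\<close>: this sum is nonnegative on positive
  semidefinite \<open>A\<close> and \<open>B\<close> because \<open>A = Y\<^sup>* Y\<close>, and rank-one matrices \<open>B\<close> detect positivity of \<open>A\<close>.
\<close>

section \<open>Positive semidefinite forms\<close>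

text \<open>Since \<open>0 \<le> z\<close> forces \<open>z\<close> to be real, Hermitian symmetry is
  a consequence and not a condition. With functions on \<open>nat\<close>, an induction drops the
  last index merely by lowering \<open>k\<close>.\<close>

definition psd :: "nat \<Rightarrow> (nat \<Rightarrow> nat \<Rightarrow> complex) \<Rightarrow> bool" where
  "psd k a \<longleftrightarrow> (\<forall>v. 0 \<le> (\<Sum>i<k. \<Sum>j<k. cnj (v i) * a i j * v j))"

lemma psd_cong:
  assumes "\<And>i j. i < k \<Longrightarrow> j < k \<Longrightarrow> a i j = b i j"
  shows "psd k a \<longleftrightarrow> psd k b"
  using assms by (simp add: psd_def)

lemma cnj_mult_self_nonneg: "0 \<le> cnj z * (z::complex)"
  by (simp add: less_eq_complex_def)

text \<open>The form at \<open>v\<close> is the squared norm of \<open>y\<close> applied to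
  \<open>v\<close>. The number \<open>d\<close> of rows is free: it is \<open>k\<close> for elements
  of an algebra cone and 1 for rank-one test matrices.\<close>

lemma psd_gram: "psd k (\<lambda>i j. \<Sum>n<d. cnj (y n i) * y n j)"
  unfolding psd_def
proof
  fix v :: "nat \<Rightarrow> complex"
  have "(\<Sum>i<k. \<Sum>j<k. cnj (v i) * (\<Sum>n<d. cnj (y n i) * y n j) * v j)
      = (\<Sum>i<k. \<Sum>j<k. \<Sum>n<d. cnj (y n i * v i) * (y n j * v j))"
    by (simp add: sum_distrib_left sum_distrib_right mult_ac)
  also have "\<dots> = (\<Sum>i<k. \<Sum>n<d. \<Sum>j<k. cnj (y n i * v i) * (y n j * v j))"
    by (intro sum.cong refl sum.swap)
  also have "\<dots> = (\<Sum>n<d. \<Sum>i<k. \<Sum>j<k. cnj (y n i * v i) * (y n j * v j))"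
    by (rule sum.swap)
  also have "\<dots> = (\<Sum>n<d. cnj (\<Sum>i<k. y n i * v i) * (\<Sum>j<k. y n j * v j))"
    by (simp only: sum_product cnj_sum)
  also have "0 \<le> \<dots>"
    by (intro sum_nonneg cnj_mult_self_nonneg)
  finally show "0 \<le> (\<Sum>i<k. \<Sum>j<k. cnj (v i) * (\<Sum>n<d. cnj (y n i) * y n j) * v j)" .
qed

lemma psd_diag:
  assumes "psd k a" "i < k"
  shows "0 \<le> a i i"
proof -
  have "0 \<le> (\<Sum>p<k. \<Sum>q<k. cnj (of_bool (p = i)) * a p q * of_bool (q = i))"
    using assms(1) by (simp only: psd_def)
  also have "\<dots> = (\<Sum>p<k. if p = i then \<Sum>q<k. if q = i then a p q else 0 else 0)"
    by (intro sum.cong) auto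
  finally show ?thesis
    using assms(2) by simp
qed

text \<open>This is the form evaluated at \<open>e_i + c e_j\<close>.\<close>

lemma psd_pair:
  assumes "psd k a" "i < k" "j < k" "i \<noteq> j"
  shows "0 \<le> a i i + c * a i j + cnj c * a j i + cnj c * c * a j j"
proof -
  define v where "v = (\<lambda>n. if n = i then 1 else if n = j then c else 0)"
  have ij: "(\<Sum>p<k. f p) = f i + f j" if "\<And>p. p \<noteq> i \<Longrightarrow> p \<noteq> j \<Longrightarrow> f p = 0" for f :: "nat \<Rightarrow> complex"
  proof -
    have "(\<Sum>p<k. f p) = (\<Sum>p\<in>{i, j}. f p)"
      by (rule sum.mono_neutral_right) (use assms that in auto)
    then show ?thesis
      using assms(4) by simp
  qed
  have "0 \<le> (\<Sum>p<k. \<Sum>q<k. cnj (v p) * a p q * v q)"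
    using assms(1) unfolding psd_def by (rule spec)
  also have "\<dots> = a i i + c * a i j + cnj c * a j i + cnj c * c * a j j"
    using assms(4) by (simp add: ij v_def algebra_simps)
  finally show ?thesis .
qed

text \<open>The values of the form at \<open>e_i + e_j\<close> and \<open>e_i + \<i> e_j\<close> are
  real, which fixes the imaginary and the real part of \<open>a j i\<close> respectively.\<close>

lemma psd_hermitian:
  assumes "psd k a" "i < k" "j < k"
  shows "a j i = cnj (a i j)"
proof (cases "i = j")
  case True
  then show ?thesis
    using psd_diag[OF assms(1,2)] by (simp add: complex_eq_iff less_eq_complex_def)
next
  case False
  have "0 \<le> a i i" "0 \<le> a j j"
    using assms psd_diag by blast+
  then show ?thesis
    using psd_pair[OF assms False, of 1] psd_pair[OF assms False, of \<i>]
    by (simp add: complex_eq_iff less_eq_complex_def)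
qed

text \<open>Without the term in \<open>a j j\<close>, the form at \<open>e_i + c e_j\<close> is real
  affine in \<open>c\<close>. It is bounded below along the line
  \<open>c = - t * cnj (a i j)\<close> only if its slope there vanishes.\<close>

lemma psd_zero_diag:
  assumes "psd k a" "i < k" "j < k" "a j j = 0"
  shows "a i j = 0"
proof (cases "i = j")
  case False
  have aji: "a j i = cnj (a i j)"
    using psd_hermitian assms by blast
  define r where "r = Re (cnj (a i j) * a i j)"
  have bound: "0 \<le> Re (a i i) - 2 * t * r" for t
    using psd_pair[OF assms(1-3) False, of "of_real (- t) * cnj (a i j)"]
    by (simp add: r_def aji assms(4) less_eq_complex_def algebra_simps)
  have "r = 0"
  proof (rule ccontr)
    assume "r \<noteq> 0"
    then show False
      \<comment> \<open>This \<open>t\<close> makes the lower bound equal to -1.\<close>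
      using bound[of "(Re (a i i) + 1) / (2 * r)"] by simp
  qed
  then show ?thesis
    by (simp add: r_def complex_eq_iff sum_squares_eq_zero_iff)
qed (use assms in simp)

text \<open>The Schur complement with respect to the last diagonal entry. If that entry vanishes, so
  does its column, and the junk value \<open>x / 0 = 0\<close> gives the right answer.\<close>

lemma psd_schur:
  assumes "psd (Suc k) a"
  shows "psd k (\<lambda>i j. a i j - a i k * a k j / a k k)"
  unfolding psd_def
proof
  fix v :: "nat \<Rightarrow> complex"
  define s where "s = (\<Sum>j<k. a k j * v j)"
  define d where "d = a k k"
  define Q where "Q = (\<Sum>i<k. \<Sum>j<k. cnj (v i) * a i j * v j)"
  \<comment> \<open>For \<open>d > 0\<close> this last coordinate minimises the form over all
    extensions of \<open>v\<close>. For \<open>d = 0\<close> it is 0, and the form reduces to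
    \<open>Q\<close>.\<close>
  define t where "t = - s / d"
  have "0 \<le> d"
    unfolding d_def using assms psd_diag by blast
  then have d: "cnj d = d"
    by (simp add: complex_eq_iff less_eq_complex_def)
  have s': "(\<Sum>i<k. cnj (v i) * a i k) = cnj s"
    unfolding s_def cnj_sum
    by (intro sum.cong refl) (use psd_hermitian[OF assms, of k] in auto)
  have "0 \<le> (\<Sum>i<Suc k. \<Sum>j<Suc k. cnj ((v(k := t)) i) * a i j * (v(k := t)) j)"
    using assms unfolding psd_def by (rule spec)
  also have "(\<Sum>i<Suc k. \<Sum>j<Suc k. cnj ((v(k := t)) i) * a i j * (v(k := t)) j)
      = Q + (\<Sum>i<k. cnj (v i) * a i k) * t + (cnj t * s + cnj t * d * t)"
    by (simp add: Q_def s_def d_def sum.distrib sum_distrib_left sum_distrib_right mult_ac)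
  also have "\<dots> = Q - cnj s * s / d"
    by (cases "d = 0") (simp_all add: s' t_def d field_simps)
  also have "\<dots> = (\<Sum>i<k. \<Sum>j<k. cnj (v i) * (a i j - a i k * a k j / a k k) * v j)"
  proof -
    have "cnj s * s / d = (\<Sum>i<k. \<Sum>j<k. cnj (v i) * a i k * (a k j * v j) / d)"
      by (simp only: s'[symmetric], simp only: s_def sum_product sum_divide_distrib)
    then show ?thesis
      by (simp add: Q_def d_def sum_subtractf ring_distribs mult_ac)
  qed
  finally show "0 \<le> (\<Sum>i<k. \<Sum>j<k. cnj (v i) * (a i j - a i k * a k j / a k k) * v j)" .
qed

text \<open>Cholesky factorisation by induction: a factor of the Schur complement is extended by one
  row that accounts for the rank-one term subtracted there.\<close>

lemma psd_cholesky:
  assumes "psd k a"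
  shows "\<exists>y. \<forall>i<k. \<forall>j<k. a i j = (\<Sum>n<k. cnj (y n i) * y n j)"
  using assms
proof (induction k arbitrary: a)
  case 0
  show ?case by simp
next
  case (Suc k)
  obtain y where y: "\<And>i j. i < k \<Longrightarrow> j < k \<Longrightarrow>
      a i j - a i k * a k j / a k k = (\<Sum>n<k. cnj (y n i) * y n j)"
    using Suc.IH[OF psd_schur[OF Suc.prems]] by blast
  define r where "r = Re (a k k)"
  have "0 \<le> a k k"
    using Suc.prems psd_diag by blast
  then have r: "0 \<le> r" "a k k = of_real r"
    by (simp_all add: r_def complex_eq_iff less_eq_complex_def)
  have herm: "a i k = cnj (a k i)" if "i < Suc k" for i
    using psd_hermitian[OF Suc.prems, of k i] that by simp
  have zero: "a i k = 0" if "r = 0" "i < Suc k" for i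
    using psd_zero_diag[OF Suc.prems, of i k] that r by simp
  define z where
    \<comment> \<open>The new row is the last row of \<open>a\<close> over the root of its diagonal
      entry. Column \<open>k\<close> of the older rows is set to 0, since the induction hypothesis
      says nothing about \<open>y n k\<close>.\<close>
    "z = (\<lambda>n j. if n = k then a k j / of_real (sqrt r) else if j = k then 0 else y n j)"
  have last: "cnj (z k i) * z k j = a i k * a k j / a k k" if "i < Suc k" for i j
    using r herm[OF that] by (simp add: z_def flip: of_real_mult)
  have "a i j = (\<Sum>n<Suc k. cnj (z n i) * z n j)" if ij: "i < Suc k" "j < Suc k" for i j
  proof (cases "i < k \<and> j < k")
    case True
    have "(\<Sum>n<k. cnj (z n i) * z n j) = (\<Sum>n<k. cnj (y n i) * y n j)"
      using True by (intro sum.cong) (auto simp: z_def)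
    moreover have "a i j = (\<Sum>n<k. cnj (y n i) * y n j) + a i k * a k j / a k k"
      using y[of i j] True by (simp add: diff_eq_eq)
    ultimately show ?thesis
      using last[OF ij(1)] by simp
  next
    case False
    then have "i = k \<or> j = k"
      using ij by auto
    then have "(\<Sum>n<k. cnj (z n i) * z n j) = 0"
      by (auto simp: z_def intro!: sum.neutral)
    moreover have "a i j = a i k * a k j / a k k"
    \<comment> \<open>If the pivot vanishes, so do its row and column, and both sides are 0.
      Otherwise one factor cancels against \<open>a k k\<close>.\<close>
    proof (cases "r = 0")
      case True
      then have "a i k = 0" "a k j = 0"
        using zero[of i] zero[of j] psd_hermitian[OF Suc.prems, of j k] ij by simp_all
      then show ?thesis
        using \<open>i = k \<or> j = k\<close> by auto
    next
      case False
      then show ?thesis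
        using \<open>i = k \<or> j = k\<close> r by auto
    qed
    ultimately show ?thesis
      using last[OF ij(1)] by simp
  qed
  then show ?case
    by blast
qed

text \<open>Factoring \<open>a\<close> alone suffices: the sum then splits into values of the form
  of \<open>b\<close> at the rows of the factor.\<close>

lemma psd_trace_nonneg:
  assumes "psd k a" "psd k b"
  shows "0 \<le> (\<Sum>i<k. \<Sum>j<k. a i j * b i j)"
proof -
  obtain y where y: "\<And>i j. i < k \<Longrightarrow> j < k \<Longrightarrow> a i j = (\<Sum>n<k. cnj (y n i) * y n j)"
    using psd_cholesky[OF assms(1)] by blast
  have "(\<Sum>i<k. \<Sum>j<k. a i j * b i j) = (\<Sum>i<k. \<Sum>j<k. \<Sum>n<k. cnj (y n i) * b i j * y n j)"
    by (intro sum.cong refl) (simp add: y sum_distrib_left mult_ac)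
  also have "\<dots> = (\<Sum>i<k. \<Sum>n<k. \<Sum>j<k. cnj (y n i) * b i j * y n j)"
    by (intro sum.cong refl sum.swap)
  also have "\<dots> = (\<Sum>n<k. \<Sum>i<k. \<Sum>j<k. cnj (y n i) * b i j * y n j)"
    by (rule sum.swap)
  also have "0 \<le> \<dots>"
  proof (rule sum_nonneg)
    show "0 \<le> (\<Sum>i<k. \<Sum>j<k. cnj (y n i) * b i j * y n j)" for n
      using assms(2) unfolding psd_def by (rule spec)
  qed
  finally show ?thesis .
qed

section \<open>Duality for cones that are pointwise positive in suitable coordinates\<close>

lemma sum_apply: "(\<Sum>a\<in>A. f a) x = (\<Sum>a\<in>A. (f a x :: 'c::comm_monoid_add))"
  by (induction A rule: infinite_finite_induct) simp_all

lemma cscale_apply: "cscale c f x = c * f x"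
  by (simp add: cscale_def)

lemma linear_on_sum:
  assumes "linear_on UNIV s T"
  shows "T (\<Sum>a\<in>A. f a) = (\<Sum>a\<in>A. T (f a))"
proof -
  have add: "T (f + g) = T f + T g" for f g
    using assms by (simp add: linear_on_def)
  then have "T 0 = 0"
    using add[of 0 0] by simp
  then show ?thesis
    by (induction A rule: infinite_finite_induct) (simp_all add: add)
qed

section \<open>Positive cones of *-algebras in function coordinates\<close>

definition pointwise_psd :: "('c \<Rightarrow> 'b \<Rightarrow> complex) \<Rightarrow> nat \<Rightarrow> 'c mat set" where
  "pointwise_psd S k = {X \<in> carrier_mat k k. \<forall>x. psd k (\<lambda>i j. S (X $$ (i, j)) x)}"

text \<open>A *-homomorphism \<open>S\<close> turns an element \<open>Y^* Y\<close> into a Gram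
  matrix at each point. Conversely, Cholesky factors chosen independently at the points assemble
  into functions, which bijectivity of \<open>S\<close> pulls back to the algebra.\<close>

lemma algebra_cone_eq_pointwise_psd:
  fixes S :: "('a \<Rightarrow> complex) \<Rightarrow> 'b \<Rightarrow> complex"
  assumes lin: "linear_on UNIV cscale S" and bij: "bij S"
    and mult: "\<And>f g x. S (prd f g) x = S f x * S g x"
    and adj: "\<And>f x. S (adj f) x = cnj (S f x)"
  shows "algebra_cone prd adj k = pointwise_psd S k"
proof -
  have gram: "S (\<Sum>n<k. prd (adj (f n)) (g n)) x = (\<Sum>n<k. cnj (S (f n) x) * S (g n) x)" for f g x
    by (simp add: linear_on_sum[OF lin] sum_apply mult adj)
  show ?thesis
  proof (intro equalityI subsetI)
    fix X
    assume "X \<in> algebra_cone prd adj k"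
    then obtain Y where
      X: "X = mat k k (\<lambda>(i, j). \<Sum>n<k. prd (adj (Y $$ (n, i))) (Y $$ (n, j)))"
      unfolding algebra_cone_def by blast
    have "psd k (\<lambda>i j. S (X $$ (i, j)) x)" for x
      by (rule psd_cong[THEN iffD2, OF _ psd_gram[of k "\<lambda>n i. S (Y $$ (n, i)) x" k]])
        (simp add: X gram)
    then show "X \<in> pointwise_psd S k"
      by (simp add: pointwise_psd_def X)
  next
    fix X
    assume X: "X \<in> pointwise_psd S k"
    then have "\<exists>y. \<forall>i<k. \<forall>j<k. S (X $$ (i, j)) x = (\<Sum>n<k. cnj (y n i) * y n j)" for x
      by (intro psd_cholesky) (simp add: pointwise_psd_def)
    then obtain y where y: "\<And>x i j. i < k \<Longrightarrow> j < k \<Longrightarrow>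
        S (X $$ (i, j)) x = (\<Sum>n<k. cnj (y x n i) * y x n j)"
      by metis
    define Y where "Y = mat k k (\<lambda>(n, i). inv_into UNIV S (\<lambda>x. y x n i))"
    have SY: "S (Y $$ (n, i)) = (\<lambda>x. y x n i)" if "n < k" "i < k" for n i
      using that bij by (simp add: Y_def surj_f_inv_f bij_is_surj)
    have "X = mat k k (\<lambda>(i, j). \<Sum>n<k. prd (adj (Y $$ (n, i))) (Y $$ (n, j)))"
    proof (rule eq_matI)
      fix i j
      assume "i < dim_row (mat k k (\<lambda>(i, j). \<Sum>n<k. prd (adj (Y $$ (n, i))) (Y $$ (n, j))))"
        and "j < dim_col (mat k k (\<lambda>(i, j). \<Sum>n<k. prd (adj (Y $$ (n, i))) (Y $$ (n, j))))"
      then have ij: "i < k" "j < k"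
        by simp_all
      then have "S (X $$ (i, j)) = S (\<Sum>n<k. prd (adj (Y $$ (n, i))) (Y $$ (n, j)))"
        by (intro ext) (simp add: gram SY y)
      then show "X $$ (i, j)
          = mat k k (\<lambda>(i, j). \<Sum>n<k. prd (adj (Y $$ (n, i))) (Y $$ (n, j))) $$ (i, j)"
        using ij bij by (simp add: inj_eq bij_is_inj)
    qed (use X in \<open>auto simp: pointwise_psd_def\<close>)
    moreover have "Y \<in> carrier_mat k k"
      by (simp add: Y_def)
    ultimately show "X \<in> algebra_cone prd adj k"
      unfolding algebra_cone_def by blast
  qed
qed

section \<open>Dual cones and pairings that are diagonal in coordinates\<close>

lemma vspace_dual:
  "vspace E = UNIV \<Longrightarrow> vspace (dual E) = {\<phi>. linear_on UNIV (*) \<phi>}"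
  by (simp add: dual_def Let_def)

lemma mcone_dual:
  "vspace E = UNIV \<Longrightarrow> mcone (dual E) k = {\<Phi> \<in> carrier_mat k k.
     (\<forall>i<k. \<forall>j<k. linear_on UNIV (*) (\<Phi> $$ (i, j))) \<and>
     (\<forall>X \<in> mcone E k. 0 \<le> (\<Sum>i<k. \<Sum>j<k. (\<Phi> $$ (i, j)) (X $$ (i, j))))}"
  by (simp add: dual_def Let_def)

text \<open>The maps \<open>S\<close> and \<open>S'\<close> are coordinates over the same finite set
  of points. The weight \<open>w\<close> absorbs normalisations: it is \<open>1 / m\<close> for the
  self-duality of the group algebra and 1 for the mixed pairing.\<close>

context
  fixes S :: "('x \<Rightarrow> complex) \<Rightarrow> 'b::finite \<Rightarrow> complex"
    and S' :: "('y \<Rightarrow> complex) \<Rightarrow> 'b \<Rightarrow> complex"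
    and T :: "('x \<Rightarrow> complex) \<Rightarrow> ('y \<Rightarrow> complex) \<Rightarrow> complex"
    and w :: real
  assumes lin: "linear_on UNIV cscale S" "linear_on UNIV cscale S'"
    and bij: "bij S" "bij S'"
    and w: "w > 0"
    and T: "\<And>f g. T f g = of_real w * (\<Sum>x\<in>UNIV. S f x * S' g x)"
begin

lemma coordinate_simps:
  "S (f + g) = S f + S g" "S (cscale c f) = cscale c (S f)" "S (inv_into UNIV S h) = h"
  "S' (f' + g') = S' f' + S' g'" "S' (cscale c f') = cscale c (S' f')" "S' (inv_into UNIV S' h) = h"
  using lin bij by (simp_all add: linear_on_def surj_f_inv_f bij_is_surj)

lemma linear_pairing: "linear_on UNIV cscale T"
  unfolding linear_on_def
  by (auto simp: fun_eq_iff T coordinate_simps cscale_apply ring_distribs sum.distrib sum_distrib_left mult_ac)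

lemma linear_pairing_apply: "linear_on UNIV (*) (T f)"
  unfolding linear_on_def
  by (auto simp: T coordinate_simps cscale_apply ring_distribs sum.distrib sum_distrib_left mult_ac)

text \<open>The basis of the second space with indicator functions as coordinates. Pairing with it
  reads off the coordinates of \<open>f\<close> up to the factor \<open>w\<close>.\<close>

abbreviation delta :: "'b \<Rightarrow> 'y \<Rightarrow> complex" where
  "delta x \<equiv> inv_into UNIV S' (\<lambda>y. of_bool (y = x))"

lemma pairing_delta: "T f (delta x) = of_real w * S f x"
  by (simp add: T coordinate_simps)

lemma bij_betw_pairing: "bij_betw T UNIV {\<phi>. linear_on UNIV (*) \<phi>}"
proof (rule bij_betw_imageI)
  show "inj T"
  proof (rule injI)
    fix f g
    assume "T f = T g"
    then have "of_real w * S f x = of_real w * S g x" for x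
      by (metis pairing_delta)
    then have "S f = S g"
      using w by (simp add: fun_eq_iff)
    then show "f = g"
      using bij by (simp add: inj_eq bij_is_inj)
  qed
  show "range T = {\<phi>. linear_on UNIV (*) \<phi>}"
  proof (intro equalityI subsetI)
    fix \<phi> :: "('y \<Rightarrow> complex) \<Rightarrow> complex"
    assume "\<phi> \<in> {\<phi>. linear_on UNIV (*) \<phi>}"
    then have \<phi>: "linear_on UNIV (*) \<phi>"
      by simp
    \<comment> \<open>The division by \<open>w\<close> makes \<open>T f\<close> agree with
      \<open>\<phi>\<close> on every \<open>delta x\<close>, hence everywhere by expanding
      \<open>g\<close> in this basis.\<close>
    define f where "f = inv_into UNIV S (\<lambda>x. \<phi> (delta x) / of_real w)"
    have "\<phi> g = T f g" for g
    proof -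
      have "S' (\<Sum>x\<in>UNIV. cscale (S' g x) (delta x)) = S' g"
        by (simp add: fun_eq_iff linear_on_sum[OF lin(2)] coordinate_simps sum_apply cscale_apply)
      then have "g = (\<Sum>x\<in>UNIV. cscale (S' g x) (delta x))"
        using bij by (simp add: inj_eq bij_is_inj)
      then have "\<phi> g = \<phi> (\<Sum>x\<in>UNIV. cscale (S' g x) (delta x))"
        by simp
      also have "\<dots> = (\<Sum>x\<in>UNIV. S' g x * \<phi> (delta x))"
        using \<phi> by (simp add: linear_on_sum[OF \<phi>] linear_on_def)
      also have "\<dots> = T f g"
        using w by (simp add: T f_def coordinate_simps sum_distrib_left mult.commute)
      finally show ?thesis .
    qed
    then show "\<phi> \<in> range T"
      by blast
  qed (use linear_pairing_apply in auto)
qed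

text \<open>The trace inequality at each point, summed over the points, gives one direction. For the
  other, test matrices of rank one concentrated at a single point recover the form of
  \<open>X\<close> there.\<close>

lemma map_mat_pairing_in_mcone_dual_iff:
  assumes F: "vspace F = UNIV" "mcone F = pointwise_psd S'"
    and X: "X \<in> carrier_mat k k"
  shows "map_mat T X \<in> mcone (dual F) k \<longleftrightarrow> X \<in> pointwise_psd S k"
proof
  assume "X \<in> pointwise_psd S k"
  then have psdX: "psd k (\<lambda>i j. S (X $$ (i, j)) x)" for x
    by (simp add: pointwise_psd_def)
  have "0 \<le> (\<Sum>i<k. \<Sum>j<k. (map_mat T X $$ (i, j)) (Z $$ (i, j)))"
    if "Z \<in> pointwise_psd S' k" for Z
  proof -
    have psdZ: "psd k (\<lambda>i j. S' (Z $$ (i, j)) x)" for x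
      using that by (simp add: pointwise_psd_def)
    have "(\<Sum>i<k. \<Sum>j<k. (map_mat T X $$ (i, j)) (Z $$ (i, j)))
        = of_real w * (\<Sum>i<k. \<Sum>j<k. \<Sum>x\<in>UNIV. S (X $$ (i, j)) x * S' (Z $$ (i, j)) x)"
      using X by (simp add: T sum_distrib_left)
    also have "(\<Sum>i<k. \<Sum>j<k. \<Sum>x\<in>UNIV. S (X $$ (i, j)) x * S' (Z $$ (i, j)) x)
        = (\<Sum>i<k. \<Sum>x\<in>UNIV. \<Sum>j<k. S (X $$ (i, j)) x * S' (Z $$ (i, j)) x)"
      by (intro sum.cong refl sum.swap)
    also have "\<dots> = (\<Sum>x\<in>UNIV. \<Sum>i<k. \<Sum>j<k. S (X $$ (i, j)) x * S' (Z $$ (i, j)) x)"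
      by (rule sum.swap)
    also have "0 \<le> of_real w * \<dots>"
    proof (rule mult_nonneg_nonneg)
      show "0 \<le> (\<Sum>x\<in>UNIV. \<Sum>i<k. \<Sum>j<k. S (X $$ (i, j)) x * S' (Z $$ (i, j)) x)"
        by (rule sum_nonneg) (rule psd_trace_nonneg[OF psdX psdZ])
    qed (use w in \<open>simp add: less_eq_complex_def\<close>)
    finally show ?thesis .
  qed
  then show "map_mat T X \<in> mcone (dual F) k"
    using X by (simp add: mcone_dual F linear_pairing_apply)
next
  assume dual: "map_mat T X \<in> mcone (dual F) k"
  have "psd k (\<lambda>i j. S (X $$ (i, j)) x)" for x
    unfolding psd_def
  proof
    fix v :: "nat \<Rightarrow> complex"
    define Z where "Z = mat k k (\<lambda>(i, j). cscale (cnj (v i) * v j) (delta x))"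
    have "psd k (\<lambda>i j. S' (Z $$ (i, j)) y)" for y
      \<comment> \<open>In coordinates \<open>Z\<close> is the Gram matrix of a single row:
        \<open>v\<close> at the point \<open>x\<close>, and 0 at all other points.\<close>
      by (rule psd_cong[THEN iffD2, OF _ psd_gram[of k "\<lambda>n j. v j * of_bool (y = x)" "Suc 0"]])
        (simp add: Z_def coordinate_simps cscale_apply)
    then have "Z \<in> mcone F k"
      by (simp add: F pointwise_psd_def Z_def)
    then have "0 \<le> (\<Sum>i<k. \<Sum>j<k. (map_mat T X $$ (i, j)) (Z $$ (i, j)))"
      using dual by (simp add: mcone_dual F)
    also have "\<dots> = (\<Sum>i<k. \<Sum>j<k. T (X $$ (i, j)) (cscale (cnj (v i) * v j) (delta x)))"
      using X by (intro sum.cong refl) (simp add: Z_def)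
    also have "\<dots> = of_real w * (\<Sum>i<k. \<Sum>j<k. cnj (v i) * S (X $$ (i, j)) x * v j)"
      using linear_pairing_apply
      by (simp add: linear_on_def pairing_delta sum_distrib_left mult_ac)
    finally show "0 \<le> (\<Sum>i<k. \<Sum>j<k. cnj (v i) * S (X $$ (i, j)) x * v j)"
      using w by (simp add: less_eq_complex_def zero_le_mult_iff)
  qed
  then show "X \<in> pointwise_psd S k"
    using X by (simp add: pointwise_psd_def)
qed

text \<open>The preceding equivalence yields complete positivity of \<open>T\<close> in one
  direction and of its inverse in the other.\<close>

lemma complete_order_iso_dual:
  assumes E: "vspace E = UNIV" "mcone E = pointwise_psd S"
    and F: "vspace F = UNIV" "mcone F = pointwise_psd S'"
  shows "complete_order_iso E (dual F) T"
  unfolding complete_order_iso_def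
proof (intro conjI)
  show "linear_on (vspace E) cscale T"
    by (simp add: E linear_pairing)
  show "bij_betw T (vspace E) (vspace (dual F))"
    by (simp add: E vspace_dual F bij_betw_pairing)
  show "completely_positive E (dual F) T"
    unfolding completely_positive_def
  proof (intro allI impI ballI)
    fix k X
    assume "X \<in> mcone E k"
    then have "X \<in> carrier_mat k k" "X \<in> pointwise_psd S k"
      by (simp_all add: E pointwise_psd_def)
    then show "map_mat T X \<in> mcone (dual F) k"
      using map_mat_pairing_in_mcone_dual_iff[OF F] by blast
  qed
  show "completely_positive (dual F) E (inv_into (vspace E) T)"
    unfolding completely_positive_def
  proof (intro allI impI ballI)
    fix k \<Phi>
    assume \<Phi>: "\<Phi> \<in> mcone (dual F) k"
    then have carrier: "\<Phi> \<in> carrier_mat k k"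
      and lin\<Phi>: "\<And>i j. i < k \<Longrightarrow> j < k \<Longrightarrow> \<Phi> $$ (i, j) \<in> range T"
      using bij_betw_imp_surj_on[OF bij_betw_pairing] by (auto simp: mcone_dual F)
    \<comment> \<open>Every entry of \<open>\<Phi>\<close> is a functional in the range of
      \<open>T\<close>, so the equivalence applies to the entrywise preimage.\<close>
    have "map_mat T (map_mat (inv_into UNIV T) \<Phi>) = \<Phi>"
      by (rule eq_matI) (use carrier lin\<Phi> in \<open>auto simp: f_inv_into_f\<close>)
    then have "map_mat (inv_into UNIV T) \<Phi> \<in> pointwise_psd S k"
      using map_mat_pairing_in_mcone_dual_iff[OF F, of "map_mat (inv_into UNIV T) \<Phi>" k] carrier \<Phi> by simp
    then show "map_mat (inv_into (vspace E) T) \<Phi> \<in> mcone E k"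
      by (simp add: E)
  qed
qed

end

section \<open>The Fourier transform on the cyclic group\<close>

text \<open>Exponents of an \<open>m\<close>-th root of unity matter only modulo \<open>m\<close>.
  This makes \<open>zpow\<close> additive although it is computed with representatives.\<close>

lemma power_int_mult_mod:
  fixes \<zeta> :: complex
  assumes "\<zeta> ^ m = 1" "m > 0"
  shows "\<zeta> powi (i * (j mod int m)) = \<zeta> powi (i * j)"
proof -
  have "\<zeta> \<noteq> 0"
    using assms by (auto simp: zero_power)
  have "i * j = i * (j mod int m) + int m * (i * (j div int m))"
    by (metis distrib_left mult.left_commute mod_mult_div_eq)
  then have "\<zeta> powi (i * j) = \<zeta> powi (i * (j mod int m)) * (\<zeta> powi int m) powi (i * (j div int m))"
    using \<open>\<zeta> \<noteq> 0\<close> by (metis power_int_add power_int_mult)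
  then show ?thesis
    using assms by simp
qed

lemma to_int_mod_ring_add:
  "to_int_mod_ring (a + b :: 'm::finite mod_ring)
    = (to_int_mod_ring a + to_int_mod_ring b) mod int CARD('m)"
  by transfer simp

lemma zpow_sym: "zpow \<zeta> k l = zpow \<zeta> l k"
  by (simp add: zpow_def mult.commute)

lemma zpow_zero [simp]: "zpow \<zeta> k 0 = 1"
  by (simp add: zpow_def)

lemma pairing_eq:
  fixes f g :: "'m::finite mod_ring \<Rightarrow> complex"
  shows "pairing f g = (\<Sum>l\<in>UNIV. f l * g (- l))"
  unfolding pairing_def conv_def
  by (rule sum.reindex_bij_witness[of _ uminus uminus]) simp_all

text \<open>The Gelfand transform of the group algebra, which diagonalises circulant matrices. Its
  kernel is conjugate to that of \<open>fourier\<close>, so the two differ by the reflection of the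
  argument that also occurs in \<open>pairing\<close>.\<close>

definition dft :: "complex \<Rightarrow> ('m::finite mod_ring \<Rightarrow> complex) \<Rightarrow> 'm mod_ring \<Rightarrow> complex" where
  "dft \<zeta> c = (\<lambda>k. \<Sum>l\<in>UNIV. c l * zpow \<zeta> k l)"

lemma linear_dft: "linear_on UNIV cscale (dft \<zeta>)"
  by (auto simp: linear_on_def fun_eq_iff dft_def cscale_def ring_distribs sum.distrib
      sum_distrib_left mult_ac)

context
  fixes \<zeta> :: complex
  assumes primitive: "primitive_root CARD('m::finite) \<zeta>"
begin

lemma root_nonzero: "\<zeta> \<noteq> 0"
  using primitive by (auto simp: primitive_root_def zero_power)

lemma zpow_add: "zpow \<zeta> k (a + b :: 'm mod_ring) = zpow \<zeta> k a * zpow \<zeta> k b"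
  using primitive root_nonzero
  by (simp add: zpow_def primitive_root_def to_int_mod_ring_add power_int_mult_mod distrib_left
      power_int_add)

text \<open>Both sides are inverse to \<open>zpow \<zeta> k a\<close>: the left by additivity, the
  right because \<open>\<zeta>\<close> has modulus 1.\<close>

lemma zpow_minus: "zpow \<zeta> k (- a :: 'm mod_ring) = cnj (zpow \<zeta> k a)"
proof -
  have "norm \<zeta> ^ CARD('m) = 1"
    using primitive by (simp add: primitive_root_def flip: norm_power)
  then have "norm \<zeta> = 1"
    using power_eq_1_iff[of "norm \<zeta>" "CARD('m)"] by simp
  then have "norm (zpow \<zeta> k a) = 1"
    by (simp add: zpow_def norm_power_int)
  then have "zpow \<zeta> k a * cnj (zpow \<zeta> k a) = 1"
    by (simp flip: complex_norm_square)
  moreover have "zpow \<zeta> k a * zpow \<zeta> k (- a) = 1"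
    by (simp flip: zpow_add)
  ultimately show ?thesis
    by (metis mult_left_cancel mult_zero_left zero_neq_one)
qed

lemma fourier_minus: "fourier \<zeta> g (- l :: 'm mod_ring) = dft \<zeta> g l"
proof -
  have "zpow (cnj \<zeta>) (- l) k = zpow \<zeta> l k" for k
    using zpow_minus[of k "- l"] by (simp add: zpow_def mult.commute)
  then show ?thesis
    by (simp add: fourier_def dft_def)
qed

text \<open>The reflection in \<open>pairing\<close> turns \<open>fourier\<close> into
  \<open>dft\<close>, whose symmetric kernel lets the transform pass from \<open>g\<close> to
  \<open>c\<close>. This is a coordinate pairing of weight 1.\<close>

lemma pairing_fourier:
  fixes c g :: "'m mod_ring \<Rightarrow> complex"
  shows "pairing c (fourier \<zeta> g) = (\<Sum>k\<in>UNIV. dft \<zeta> c k * g k)"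
proof -
  have "pairing c (fourier \<zeta> g) = (\<Sum>l\<in>UNIV. \<Sum>k\<in>UNIV. c l * (g k * zpow \<zeta> l k))"
    by (simp add: pairing_eq fourier_minus dft_def sum_distrib_left)
  also have "\<dots> = (\<Sum>k\<in>UNIV. \<Sum>l\<in>UNIV. c l * (g k * zpow \<zeta> l k))"
    by (rule sum.swap)
  finally show ?thesis
    by (simp add: dft_def sum_distrib_left zpow_sym mult_ac)
qed

text \<open>Orthogonality of characters: translation by a generator multiplies the sum by a value
  that differs from 1 when \<open>l\<close> is nonzero, by primitivity of
  \<open>\<zeta>\<close>.\<close>

lemma sum_zpow:
  fixes l :: "'m mod_ring"
  shows "(\<Sum>x\<in>UNIV. zpow \<zeta> l x) = (if l = 0 then of_nat CARD('m) else 0)"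
proof (cases "l = 0")
  case False
  let ?n = "to_int_mod_ring l"
  have "?n \<in> {0..<int CARD('m)}"
    using range_to_int_mod_ring by blast
  moreover have "?n \<noteq> 0"
    using False by simp
  ultimately have n: "0 < ?n" "?n < int CARD('m)"
    unfolding atLeastLessThan_iff by linarith+
  \<comment> \<open>The generator is the class of 1. Its representative is 1 because a nonzero
    \<open>l\<close> forces \<open>m > 1\<close>.\<close>
  define a :: "'m mod_ring" where "a = of_int_mod_ring 1"
  have "to_int_mod_ring a = 1"
    unfolding a_def using n by (intro to_int_mod_ring_of_int_mod_ring) auto
  then have "zpow \<zeta> l a = \<zeta> ^ nat ?n"
    using n by (simp add: zpow_def power_int_nonneg_exp)
  then have "zpow \<zeta> l a \<noteq> 1"
    using primitive n by (simp add: primitive_root_def)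
  have "(\<Sum>x\<in>UNIV. zpow \<zeta> l x) = (\<Sum>x\<in>UNIV. zpow \<zeta> l (a + x))"
    by (rule sum.reindex_bij_witness[of _ "\<lambda>x. a + x" "\<lambda>x. x - a"]) simp_all
  also have "\<dots> = zpow \<zeta> l a * (\<Sum>x\<in>UNIV. zpow \<zeta> l x)"
    by (simp add: zpow_add sum_distrib_left)
  finally show ?thesis
    using False \<open>zpow \<zeta> l a \<noteq> 1\<close> by simp
qed (simp add: zpow_sym[of _ 0])

lemma dft_conv:
  fixes f g :: "'m mod_ring \<Rightarrow> complex"
  shows "dft \<zeta> (f \<star> g) x = dft \<zeta> f x * dft \<zeta> g x"
proof -
  have "dft \<zeta> (f \<star> g) x = (\<Sum>j\<in>UNIV. \<Sum>l\<in>UNIV. f (j - l) * g l * zpow \<zeta> x j)"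
    by (simp add: dft_def conv_def sum_distrib_right)
  also have "\<dots> = (\<Sum>l\<in>UNIV. \<Sum>j\<in>UNIV. f (j - l) * g l * zpow \<zeta> x j)"
    by (rule sum.swap)
  also have "\<dots> = (\<Sum>l\<in>UNIV. \<Sum>j\<in>UNIV. f j * g l * zpow \<zeta> x (j + l))"
  proof (rule sum.cong[OF refl])
    show "(\<Sum>j\<in>UNIV. f (j - l) * g l * zpow \<zeta> x j)
        = (\<Sum>j\<in>UNIV. f j * g l * zpow \<zeta> x (j + l))" for l
      by (rule sum.reindex_bij_witness[of _ "\<lambda>j. j + l" "\<lambda>j. j - l"]) simp_all
  qed
  also have "\<dots> = (\<Sum>l\<in>UNIV. \<Sum>j\<in>UNIV. (f j * zpow \<zeta> x j) * (g l * zpow \<zeta> x l))"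
    by (simp add: zpow_add mult_ac)
  also have "\<dots> = (\<Sum>j\<in>UNIV. \<Sum>l\<in>UNIV. (f j * zpow \<zeta> x j) * (g l * zpow \<zeta> x l))"
    by (rule sum.swap)
  finally show ?thesis
    by (simp only: dft_def sum_product)
qed

lemma dft_conv_adj: "dft \<zeta> (conv_adj f) (x :: 'm mod_ring) = cnj (dft \<zeta> f x)"
  unfolding dft_def conv_adj_def cnj_sum complex_cnj_mult
  by (rule sum.reindex_bij_witness[of _ uminus uminus]) (simp_all add: zpow_minus)

text \<open>Fourier inversion at 0: summing the transform of \<open>f \<star> g\<close> over all
  characters gives \<open>m\<close> times its value at 0.\<close>

lemma pairing_dft:
  fixes f g :: "'m mod_ring \<Rightarrow> complex"
  shows "pairing f g = of_real (1 / CARD('m)) * (\<Sum>x\<in>UNIV. dft \<zeta> f x * dft \<zeta> g x)"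
proof -
  have "(\<Sum>x\<in>UNIV. dft \<zeta> f x * dft \<zeta> g x) = (\<Sum>x\<in>UNIV. dft \<zeta> (f \<star> g) x)"
    by (simp add: dft_conv)
  also have "\<dots> = (\<Sum>l\<in>UNIV. \<Sum>x\<in>UNIV. (f \<star> g) l * zpow \<zeta> x l)"
    unfolding dft_def by (rule sum.swap)
  also have "\<dots> = (\<Sum>l\<in>UNIV. (f \<star> g) l * (if l = 0 then of_nat CARD('m) else 0))"
    by (simp add: zpow_sym[of _ _ l for l] sum_zpow flip: sum_distrib_left)
  also have "\<dots> = pairing f g * of_nat CARD('m)"
    by (simp add: pairing_def if_distrib cong: if_cong)
  finally show ?thesis
    by simp
qed

lemma bij_dft: "bij (dft \<zeta> :: ('m mod_ring \<Rightarrow> complex) \<Rightarrow> _)"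
proof (rule bijI)
  show "inj (dft \<zeta> :: ('m mod_ring \<Rightarrow> complex) \<Rightarrow> _)"
  proof (rule injI)
    fix f g :: "'m mod_ring \<Rightarrow> complex"
    assume "dft \<zeta> f = dft \<zeta> g"
    then have "pairing f h = pairing g h" for h
      by (simp add: pairing_dft)
    \<comment> \<open>By its reflection, the pairing with the indicator of \<open>- x\<close>
      returns the value at \<open>x\<close>.\<close>
    from this[of "\<lambda>y. of_bool (- y = x)" for x] show "f = g"
      by (simp add: pairing_eq fun_eq_iff)
  qed
  show "surj (dft \<zeta> :: ('m mod_ring \<Rightarrow> complex) \<Rightarrow> _)"
  proof (rule surjI)
    fix h :: "'m mod_ring \<Rightarrow> complex"
    \<comment> \<open>The inverse Fourier transform of \<open>h\<close>; orthogonality at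
      \<open>k - x\<close> then isolates the term \<open>x = k\<close>.\<close>
    let ?c = "\<lambda>a. (\<Sum>x\<in>UNIV. h x * zpow \<zeta> a (- x)) / of_nat CARD('m)"
    show "dft \<zeta> ?c = h"
    proof
      fix k
      have "dft \<zeta> ?c k = (\<Sum>a\<in>UNIV. \<Sum>x\<in>UNIV. h x * zpow \<zeta> a (k - x)) / of_nat CARD('m)"
        using zpow_add[of _ k "- x" for x]
        by (simp add: dft_def zpow_sym[of _ k] sum_distrib_left sum_distrib_right sum_divide_distrib mult_ac)
      also have "(\<Sum>a\<in>UNIV. \<Sum>x\<in>UNIV. h x * zpow \<zeta> a (k - x))
          = (\<Sum>x\<in>UNIV. \<Sum>a\<in>UNIV. h x * zpow \<zeta> (k - x) a)"
        by (subst sum.swap) (simp add: zpow_sym)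
      also have "\<dots> = (\<Sum>x\<in>UNIV. h x * (if k = x then of_nat CARD('m) else 0))"
        by (simp add: sum_zpow flip: sum_distrib_left)
      also have "\<dots> = h k * of_nat CARD('m)"
        by (simp add: if_distrib cong: if_cong)
      finally show "dft \<zeta> ?c k = h k"
        by simp
    qed
  qed
qed

end

section \<open>The two operator systems in coordinates and their dualities\<close>

lemma mcone_group_cstar:
  assumes "primitive_root CARD('m::finite) \<zeta>"
  shows "mcone (group_cstar :: 'm mod_ring matrix_ordered) = pointwise_psd (dft \<zeta>)"
  unfolding group_cstar_def
  by (simp add: fun_eq_iff algebra_cone_eq_pointwise_psd[OF linear_dft bij_dft[OF assms]
      dft_conv[OF assms] dft_conv_adj[OF assms]])

lemma linear_id: "linear_on UNIV cscale (\<lambda>f. f)"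
  by (simp add: linear_on_def)

lemma mcone_linf: "mcone linf = pointwise_psd (\<lambda>f. f)"
  unfolding linf_def
  by (simp add: fun_eq_iff algebra_cone_eq_pointwise_psd[OF linear_id bij_id[unfolded id_def]])

theorem proposition5p1:
  fixes \<zeta> :: complex
  assumes "primitive_root CARD('m::finite) \<zeta>"
  shows
    "(\<forall>f g :: 'm mod_ring \<Rightarrow> complex. pairing f g = (\<Sum>l\<in>UNIV. f l * g (- l))) \<and>
     complete_order_iso group_cstar (dual group_cstar)
       (\<lambda>f :: 'm mod_ring \<Rightarrow> complex. \<lambda>g. pairing f g) \<and>
     (\<forall>c g :: 'm mod_ring \<Rightarrow> complex.
        pairing c (fourier \<zeta> g) = (\<Sum>l\<in>UNIV. \<Sum>k\<in>UNIV. c l * g k * zpow \<zeta> k l)) \<and>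
     complete_order_iso group_cstar (dual linf)
       (\<lambda>c :: 'm mod_ring \<Rightarrow> complex. \<lambda>g. pairing c (fourier \<zeta> g)) \<and>
     complete_order_iso linf (dual group_cstar)
       (\<lambda>g :: 'm mod_ring \<Rightarrow> complex. \<lambda>c. pairing c (fourier \<zeta> g))"
proof (intro conjI allI)
  note group = mcone_group_cstar[OF assms] and bij = bij_dft[OF assms] bij_id[unfolded id_def]
  have vspace: "vspace group_cstar = UNIV" "vspace linf = UNIV"
    by (simp_all add: group_cstar_def linf_def)
  show "pairing f g = (\<Sum>l\<in>UNIV. f l * g (- l))" for f g :: "'m mod_ring \<Rightarrow> complex"
    by (rule pairing_eq)
  show "pairing c (fourier \<zeta> g) = (\<Sum>l\<in>UNIV. \<Sum>k\<in>UNIV. c l * g k * zpow \<zeta> k l)"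
    for c g :: "'m mod_ring \<Rightarrow> complex"
    by (simp add: pairing_eq fourier_minus[OF assms] dft_def sum_distrib_left zpow_sym mult_ac)
  show "complete_order_iso group_cstar (dual group_cstar)
      (\<lambda>f :: 'm mod_ring \<Rightarrow> complex. \<lambda>g. pairing f g)"
    \<comment> \<open>Both sides use \<open>dft\<close> coordinates, with weight
      \<open>1 / m\<close>.\<close>
    by (rule complete_order_iso_dual[OF linear_dft linear_dft bij(1) bij(1) _ pairing_dft[OF assms]])
      (simp_all add: vspace group)
  show "complete_order_iso group_cstar (dual linf)
      (\<lambda>c :: 'm mod_ring \<Rightarrow> complex. \<lambda>g. pairing c (fourier \<zeta> g))"
    \<comment> \<open>Only the group algebra is transformed; functions in \<open>linf\<close> are
      their own coordinates.\<close>
    by (rule complete_order_iso_dual[where w = 1, OF linear_dft linear_id bij(1) bij(2)])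
      (simp_all add: vspace group mcone_linf pairing_fourier[OF assms])
  show "complete_order_iso linf (dual group_cstar)
      (\<lambda>g :: 'm mod_ring \<Rightarrow> complex. \<lambda>c. pairing c (fourier \<zeta> g))"
    by (rule complete_order_iso_dual[where w = 1, OF linear_id linear_dft bij(2) bij(1)])
      (simp_all add: vspace group mcone_linf pairing_fourier[OF assms] mult.commute)
qed

end
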